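(* Let $q = p^e$ be a power of a prime $p$ such that $q \equiv 1 \pmod 3$. Let $\chi_3$ be a cubic character (a multiplicative character of exact order $3$) of $\mathbb{F}_q^{\times}$ and let $\varepsilon$ be the trivial character. Let $\lambda, \mu \in \mathbb{F}_q$ with $\lambda\mu(\lambda-1)(\mu-1) \neq 0$ and $\lambda \neq \mu$, and let $C$ be the smooth projective curve of genus $3$ over $\mathbb{F}_q$ with affine model \[ y^3 = x(x-1)(x-\lambda)(x-\mu). \] Then \[ a_q(C) = -q \sum_{j=1}^{2} \chi_3^{2j}(-1)\, F_1\!\left(\chi_3^j, \chi_3^j, \chi_3^j; \varepsilon; \lambda, \mu\right)_q . \]
   Context: $\mathbb{F}_q$ is the finite field with $q$ elements and $\widehat{\mathbb{F}_q^{\times}}$ is the group of (complex-valued) characters of $\mathbb{F}_q^{\times}$, with trivial character $\varepsilon$; $\overline{\chi}$ is the inverse (complex conjugate) of $\chi$, and products of characters are written by juxtaposition. Every character $\chi$ is extended to all of $\mathbb{F}_q$ by setting $\chi(0)=0$ if $\chi\neq\varepsilon$ and $\chi(0)=1$ if $\chi=\varepsilon$. For characters $A,B$ the Jacobi sum is $J(A,B)=\sum_{t\in\mathbb{F}_q}A(t)B(1-t)$, and the normalized Jacobi sum is \[ \binom{A}{B} = \frac{B(-1)}{q} J(A,\overline{B}). \] For characters $A,B_1,B_2,D\in\widehat{\mathbb{F}_q^{\times}}$ and $x,y\in\mathbb{F}_q$, the finite field Appell hypergeometric function is \[ F_1(A,B_1,B_2;D;x,y)_q = \frac{q^2}{(q-1)^2}\sum_{\chi_1,\chi_2\in\widehat{\mathbb{F}_q^{\times}}}\binom{A\chi_1\chi_2}{D\chi_1\chi_2}\binom{B_1\chi_1}{\chi_1}\binom{B_2\chi_2}{\chi_2}\chi_1(x)\chi_2(y).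 \] The trace of Frobenius for the curve $C$ is $a_q(C)=1+q-\sharp C(\mathbb{F}_q)$, where $\sharp C(\mathbb{F}_q)$ is the number of $\mathbb{F}_q$-rational points of $C$.
   Formalization: All characters, including the trivial one, are extended by 0 at 0 (ε(0)=0) instead of ε(0)=1; with ε(0)=1 the identity fails, e.g. for q=7, λ=2, μ=3 the left side is 0 and the right side is 1.5. *)

theory Defs
  imports
    Complex_Main
    "HOL-Library.FuncSet"
    "HOL-Library.Cardinality"
    "HOL-Number_Theory.Cong"
begin

text \<open>
  A character of the unit group of a finite field is represented by its extension by zero to
  the whole field, so that each character is exactly one function and products and inverses
  are pointwise. The extension by zero is used for the trivial character as well (Greene's
  convention). This differs from the convention that extends the trivial character by the
  value 1 at 0: the latter adds boundary terms to the Jacobi sums with a trivial argument, and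
  the expression of the trace of Frobenius below by Appell functions then fails, for example
  for the field with 7 elements and the parameters 2, 3.
\<close>

definition mult_chars :: "('a::{finite,field} \<Rightarrow> complex) set" where
  "mult_chars = {\<chi>. \<chi> 0 = 0 \<and> \<chi> 1 = 1 \<and> (\<forall>x y. x \<noteq> 0 \<longrightarrow> y \<noteq> 0 \<longrightarrow> \<chi> (x * y) = \<chi> x * \<chi> y)}"

definition triv_char :: "'a::{finite,field} \<Rightarrow> complex" where
  "triv_char x = (if x = 0 then 0 else 1)"

definition char_mult :: "('a::{finite,field} \<Rightarrow> complex) \<Rightarrow> ('a \<Rightarrow> complex) \<Rightarrow> 'a \<Rightarrow> complex"
    (infixl \<open>\<odot>\<close> 70) where
  "(\<chi> \<odot> \<psi>) x = \<chi> x * \<psi> x"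

definition char_cnj :: "('a::{finite,field} \<Rightarrow> complex) \<Rightarrow> 'a \<Rightarrow> complex" where
  "char_cnj \<chi> x = cnj (\<chi> x)"

primrec char_pow :: "('a::{finite,field} \<Rightarrow> complex) \<Rightarrow> nat \<Rightarrow> 'a \<Rightarrow> complex" where
  "char_pow \<chi> 0 = triv_char"
| "char_pow \<chi> (Suc n) = char_pow \<chi> n \<odot> \<chi>"

definition has_char_order :: "('a::{finite,field} \<Rightarrow> complex) \<Rightarrow> nat \<Rightarrow> bool" where
  "has_char_order \<chi> n \<longleftrightarrow>
     n > 0 \<and> char_pow \<chi> n = triv_char \<and> (\<forall>m. 0 < m \<and> m < n \<longrightarrow> char_pow \<chi> m \<noteq> triv_char)"

definition jacobi_sum :: "('a::{finite,field} \<Rightarrow> complex) \<Rightarrow> ('a \<Rightarrow> complex) \<Rightarrow> complex" where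
  "jacobi_sum A B = (\<Sum>t\<in>UNIV. A t * B (1 - t))"

definition char_binom :: "('a::{finite,field} \<Rightarrow> complex) \<Rightarrow> ('a \<Rightarrow> complex) \<Rightarrow> complex" where
  "char_binom A B = B (-1) / of_nat CARD('a) * jacobi_sum A (char_cnj B)"

definition appell_F1 ::
  "('a::{finite,field} \<Rightarrow> complex) \<Rightarrow> ('a \<Rightarrow> complex) \<Rightarrow> ('a \<Rightarrow> complex) \<Rightarrow> ('a \<Rightarrow> complex)
     \<Rightarrow> 'a \<Rightarrow> 'a \<Rightarrow> complex" where
  "appell_F1 A B\<^sub>1 B\<^sub>2 D x y =
     of_nat CARD('a) ^ 2 / (of_nat CARD('a) - 1) ^ 2 *
     (\<Sum>\<chi>\<^sub>1\<in>mult_chars. \<Sum>\<chi>\<^sub>2\<in>mult_chars.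
        char_binom (A \<odot> \<chi>\<^sub>1 \<odot> \<chi>\<^sub>2) (D \<odot> \<chi>\<^sub>1 \<odot> \<chi>\<^sub>2) *
        char_binom (B\<^sub>1 \<odot> \<chi>\<^sub>1) \<chi>\<^sub>1 * char_binom (B\<^sub>2 \<odot> \<chi>\<^sub>2) \<chi>\<^sub>2 * \<chi>\<^sub>1 x * \<chi>\<^sub>2 y)"

definition proj_rel :: "(('a::field \<times> 'a \<times> 'a) \<times> ('a \<times> 'a \<times> 'a)) set" where
  "proj_rel = {((x, y, z), (x', y', z')). (x, y, z) \<noteq> (0, 0, 0) \<and>
     (\<exists>c. c \<noteq> 0 \<and> x' = c * x \<and> y' = c * y \<and> z' = c * z)}"

definition proj_plane :: "('a::field \<times> 'a \<times> 'a) set set" where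
  "proj_plane = (UNIV - {(0, 0, 0)}) // proj_rel"

text \<open>
  The curve is the projective closure of the affine curve, which is a plane quartic. It is
  nonsingular over every extension field by the lemma \<open>quartic_form_smooth\<close> below, so it is
  the smooth projective model, and its genus is (4 - 1)(4 - 2)/2 = 3.
\<close>

fun quartic_form :: "'a::field \<Rightarrow> 'a \<Rightarrow> 'a \<times> 'a \<times> 'a \<Rightarrow> 'a" where
  "quartic_form l m (x, y, z) = y ^ 3 * z - x * (x - z) * (x - l * z) * (x - m * z)"

definition curve_points :: "'a::field \<Rightarrow> 'a \<Rightarrow> ('a \<times> 'a \<times> 'a) set set" where
  "curve_points l m = {P \<in> proj_plane. \<forall>v\<in>P. quartic_form l m v = 0}"

definition frob_trace :: "'a::{finite,field} \<Rightarrow> 'a \<Rightarrow> int" where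
  "frob_trace l m = 1 + int CARD('a) - int (card (curve_points l m))"

lemma quartic_form_affine:
  "quartic_form l m (x, y, 1) = 0 \<longleftrightarrow> y ^ 3 = x * (x - 1) * (x - l) * (x - m)"
  by simp

text \<open>The last three assumptions say that the partial derivatives by x, y, z vanish.\<close>

lemma quartic_form_smooth:
  fixes l m x y z :: "'k::field"
  assumes "(3::'k) \<noteq> 0" and "l * m * (l - 1) * (m - 1) \<noteq> 0" and "l \<noteq> m"
    and F: "quartic_form l m (x, y, z) = 0"
    and Fx: "- ((x - z) * (x - l * z) * (x - m * z) + x * (x - l * z) * (x - m * z)
               + x * (x - z) * (x - m * z) + x * (x - z) * (x - l * z)) = 0"
    and Fy: "3 * y ^ 2 * z = 0"
    and Fz: "y ^ 3 + x * (x - l * z) * (x - m * z) + l * x * (x - z) * (x - m * z)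
               + m * x * (x - z) * (x - l * z) = 0"
  shows "(x, y, z) = (0, 0, 0)"
proof (cases "z = 0")
  case True
  then have "x = 0" using F by simp
  then show ?thesis using True Fz by simp
next
  case z: False
  then have y: "y = 0" using Fy assms(1) by simp
  have "x = 0 \<or> x = z \<or> x = l * z \<or> x = m * z" using F y by simp
  then show ?thesis
  proof (elim disjE)
    assume "x = 0" then show ?thesis using Fx z assms(2) by simp
  next
    assume x: "x = z"
    have "z * (z - l * z) * (z - m * z) = 0" using Fx unfolding x by simp
    then show ?thesis using z assms(2) by simp
  next
    assume x: "x = l * z"
    have "l * z * (l * z - z) * (l * z - m * z) = 0" using Fx unfolding x by simp
    then show ?thesis using z assms(2,3) by simp
  next
    assume x: "x = m * z"
    have "m * z * (m * z - z) * (m * z - l * z) = 0" using Fx unfolding x by simp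
    then show ?thesis using z assms(2,3) by simp
  qed
qed

lemma finite_mult_chars: "finite (mult_chars :: ('a::{finite,field} \<Rightarrow> complex) set)"
proof -
  let ?n = "card (UNIV - {0 :: 'a})"
  let ?R = "insert 0 {z :: complex. z ^ ?n = 1}"
  have "\<chi> x ^ ?n = 1" if \<chi>: "\<chi> \<in> mult_chars" and x: "x \<noteq> 0" for \<chi> and x :: 'a
  proof -
    have one: "\<chi> 1 = 1" and mult: "\<And>u v. u \<noteq> 0 \<Longrightarrow> v \<noteq> 0 \<Longrightarrow> \<chi> (u * v) = \<chi> u * \<chi> v"
      using \<chi> unfolding mult_chars_def by simp_all
    have nz: "\<chi> y \<noteq> 0" if "y \<noteq> 0" for y
      using mult[of y "inverse y"] one that by auto
    have "(\<Prod>y\<in>UNIV - {0}. \<chi> y) = (\<Prod>y\<in>UNIV - {0}. \<chi> (x * y))"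
      by (rule prod.reindex_bij_witness[of _ "\<lambda>y. x * y" "\<lambda>y. y / x"]) (use x in auto)
    also have "\<dots> = (\<Prod>y\<in>UNIV - {0}. \<chi> x * \<chi> y)"
      by (rule prod.cong) (use x in \<open>simp_all add: mult\<close>)
    also have "\<dots> = \<chi> x ^ ?n * (\<Prod>y\<in>UNIV - {0}. \<chi> y)"
      by (simp add: prod.distrib)
    finally show ?thesis using nz by (simp add: prod_zero_iff)
  qed
  then have val: "\<chi> x \<in> ?R" if "\<chi> \<in> mult_chars" for \<chi> and x :: 'a
    using that by (cases "x = 0") (simp_all add: mult_chars_def)
  have sub: "(mult_chars :: ('a \<Rightarrow> complex) set) \<subseteq> PiE UNIV (\<lambda>_. ?R)"
    by (rule subsetI, rule PiE_I) (use val in blast, simp)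
  have "(1 :: 'a) \<in> UNIV - {0}" by simp
  then have "?n > 0" by (metis card_gt_0_iff empty_iff finite)
  then have R: "finite ?R" by (simp add: finite_roots_unity)
  show ?thesis by (rule finite_subset[OF sub finite_PiE]) (use R in simp_all)
qed

end

theory Submission
  imports Defs "HOL-Algebra.Multiplicative_Group"
begin

no_notation smult (infixl \<open>\<odot>\<index>\<close> 70)

text \<open>
  Orthogonality of characters collapses the double sum over characters in \<open>F\<^sub>1\<close> to a one-variable
  character sum, the finite field version of Euler's integral. For cubic characters the
  substitution \<open>t = 1 / (1 - x)\<close> turns it into the sum of the conjugate of \<open>\<omega> (f x)\<close>,
  where \<open>f x = x (x - 1) (x - l) (x - m)\<close>. On the other side, \<open>y\<^sup>3 = a\<close> has
  \<open>1 + \<omega> a + cnj (\<omega> a)\<close> solutions, and the curve has one point at infinity.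
\<close>

section \<open>Characters of a finite field\<close>

lemma card_field_gt_1: "CARD('a::{finite,field}) > 1"
proof -
  have "card {0, 1 :: 'a} \<le> CARD('a)"
    by (rule card_mono) simp_all
  then show ?thesis by simp
qed

lemma card_nonzero: "card (UNIV - {0 :: 'a::{finite,field}}) = CARD('a) - 1"
  by (simp add: card_Diff_subset)

text \<open>Multiplication by \<open>x\<close> permutes the units, so their nonzero product equals
  itself times \<open>x ^ (CARD('a) - 1)\<close>.\<close>

lemma field_power_card_minus_1:
  fixes x :: "'a::{finite,field}"
  assumes x: "x \<noteq> 0"
  shows "x ^ (CARD('a) - 1) = 1"
proof -
  have "(\<Prod>y\<in>UNIV - {0}. y) = (\<Prod>y\<in>UNIV - {0}. x * y)"
    by (rule prod.reindex_bij_witness[of _ "\<lambda>y. x * y" "\<lambda>y. y / x"]) (use x in auto)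
  also have "\<dots> = x ^ (CARD('a) - 1) * (\<Prod>y\<in>UNIV - {0}. y)"
    by (simp add: prod.distrib card_nonzero)
  finally show ?thesis by (simp add: prod_zero_iff)
qed

lemma power_mod_exponent:
  fixes x :: "'a::monoid_mult"
  assumes "x ^ n = 1"
  shows "x ^ (i mod n) = x ^ i"
proof -
  have "x ^ i = x ^ (n * (i div n) + i mod n)" by simp
  then show ?thesis by (simp only: power_add power_mult assms power_one mult_1)
qed

text \<open>Cyclicity of the unit group. The field is repackaged as a ring record \<open>R\<close>
  so that the HOL-Algebra theorem on its multiplicative group applies; exponents are then reduced
  below \<open>CARD('a) - 1\<close>, and counting gives injectivity.\<close>

lemma ex_field_generator:
  "\<exists>g :: 'a::{finite,field}. g \<noteq> 0 \<and> bij_betw (\<lambda>i. g ^ i) {..<CARD('a) - 1} (UNIV - {0})"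
proof -
  define R :: "'a ring" where
    "R = \<lparr>carrier = UNIV, mult = (*), one = 1, zero = 0, add = (+)\<rparr>"
  have "abelian_group R"
    by (rule abelian_groupI)
       (auto simp: R_def add.assoc add.commute intro: exI[of _ "- x" for x] right_minus)
  moreover have "Group.comm_monoid R"
    by (rule Group.comm_monoidI) (auto simp: R_def mult.assoc mult.commute)
  ultimately have "cring R"
    by (rule cringI) (simp add: R_def distrib_right)
  then interpret R: field R
  proof (rule cring.cring_fieldI2)
    show "\<exists>b\<in>carrier R. a \<otimes>\<^bsub>R\<^esub> b = \<one>\<^bsub>R\<^esub>" if "a \<noteq> \<zero>\<^bsub>R\<^esub>" for a
      using that by (intro bexI[of _ "inverse a"]) (simp_all add: R_def)
  qed (simp add: R_def)
  have pow: "a [^]\<^bsub>R\<^esub> i = a ^ i" for a and i :: nat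
    by (induction i) (simp_all add: R_def mult.commute)
  have "finite (carrier R)" by (simp add: R_def)
  from R.finite_field_mult_group_has_gen[OF this]
  have "\<exists>g\<in>UNIV - {0 :: 'a}. UNIV - {0} = {g ^ i | i :: nat. i \<in> UNIV}"
    unfolding pow carrier_mult_of by (simp add: R_def)
  then obtain g :: 'a where g: "g \<in> UNIV - {0}" "UNIV - {0} = {g ^ i | i :: nat. i \<in> UNIV}"
    by (rule bexE)
  let ?n = "CARD('a) - 1"
  have n: "?n > 0" using card_field_gt_1[where 'a='a] by simp
  have "g ^ ?n = 1" using g(1) by (intro field_power_card_minus_1) simp
  then have mod: "g ^ (i mod ?n) = g ^ i" for i
    by (rule power_mod_exponent)
  have "UNIV - {0} \<subseteq> (\<lambda>i. g ^ i) ` {..<?n}"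
  proof
    fix x :: 'a
    assume "x \<in> UNIV - {0}"
    then obtain i where "x = g ^ i" unfolding g(2) by blast
    then have "x = g ^ (i mod ?n)" using mod by simp
    then show "x \<in> (\<lambda>i. g ^ i) ` {..<?n}" using n by auto
  qed
  moreover have "(\<lambda>i. g ^ i) ` {..<?n} \<subseteq> UNIV - {0}" using g(1) by auto
  ultimately have im: "(\<lambda>i. g ^ i) ` {..<?n} = UNIV - {0}" by blast
  then have "inj_on (\<lambda>i. g ^ i) {..<?n}"
    by (intro eq_card_imp_inj_on) (simp_all add: card_nonzero)
  with im g(1) show ?thesis by (auto simp: bij_betw_def)
qed

section \<open>Values of characters and the size of the character group\<close>

lemma mult_char_0: "\<chi> \<in> mult_chars \<Longrightarrow> \<chi> 0 = 0"
  and mult_char_1: "\<chi> \<in> mult_chars \<Longrightarrow> \<chi> 1 = 1"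
  by (simp_all add: mult_chars_def)

text \<open>Because of the extension by zero, both sides vanish when an argument is 0, so this
  rewrites without side conditions.\<close>

lemma mult_char_mult: "\<chi> \<in> mult_chars \<Longrightarrow> \<chi> (x * y) = \<chi> x * \<chi> y"
  by (cases "x = 0 \<or> y = 0") (auto simp: mult_chars_def)

lemma mult_char_power: "\<chi> \<in> mult_chars \<Longrightarrow> \<chi> (x ^ i) = \<chi> x ^ i"
  by (induction i) (simp_all add: mult_char_1 mult_char_mult)

lemma mult_char_power_card:
  fixes x :: "'a::{finite,field}"
  assumes "\<chi> \<in> mult_chars" "x \<noteq> 0"
  shows "\<chi> x ^ (CARD('a) - 1) = 1"
  using assms by (metis mult_char_power mult_char_1 field_power_card_minus_1)

text \<open>Values at units are roots of unity, hence of norm 1, so conjugation inverts them. At 0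
  both sides vanish, since \<open>inverse 0 = 0\<close>.\<close>

lemma mult_char_cnj:
  fixes x :: "'a::{finite,field}"
  assumes "\<chi> \<in> mult_chars"
  shows "cnj (\<chi> x) = \<chi> (inverse x)"
proof (cases "x = 0")
  case True
  then show ?thesis using assms by (simp add: mult_char_0)
next
  case False
  have "norm (\<chi> x) = 1"
    using power_eq_1_iff[OF mult_char_power_card[OF assms False]] card_field_gt_1[where 'a='a]
    by simp
  then have "\<chi> x * cnj (\<chi> x) = 1"
    by (simp add: complex_norm_square[symmetric])
  moreover have "\<chi> x * \<chi> (inverse x) = 1"
    using assms False by (simp add: mult_char_mult[symmetric] mult_char_1)
  ultimately show ?thesis
    by (metis mult_cancel_left mult_zero_left zero_neq_one)
qed

text \<open>A character is determined by its value at the generator \<open>g\<close>, and each root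
  of unity \<open>z\<close> is attained by the character sending \<open>g ^ i\<close> to
  \<open>z ^ i\<close>.\<close>

lemma bij_betw_mult_chars_roots_unity:
  fixes g :: "'a::{finite,field}"
  assumes g0: "g \<noteq> 0" and g: "bij_betw (\<lambda>i. g ^ i) {..<CARD('a) - 1} (UNIV - {0})"
  shows "bij_betw (\<lambda>\<chi>. \<chi> g) mult_chars {z :: complex. z ^ (CARD('a) - 1) = 1}"
proof -
  let ?n = "CARD('a) - 1"
  have n: "?n > 0" using card_field_gt_1[where 'a='a] by simp
  \<comment> \<open>Discrete logarithm to base \<open>g\<close>, with values below
    \<open>?n\<close>.\<close>
  define dlog where "dlog = inv_into {..<?n} (\<lambda>i. g ^ i)"
  have dlog: "g ^ dlog x = x" "dlog x < ?n" if "x \<noteq> 0" for x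
    using bij_betw_inv_into_right[OF g, of x] bij_betw_apply[OF bij_betw_inv_into[OF g], of x] that
    by (auto simp: dlog_def)
  have dlog_pow: "dlog (g ^ i) = i mod ?n" for i
  proof -
    have "g ^ (i mod ?n) = g ^ i"
      by (rule power_mod_exponent[OF field_power_card_minus_1[OF g0]])
    then show ?thesis
      using bij_betw_inv_into_left[OF g, of "i mod ?n"] n by (simp add: dlog_def)
  qed
  have "inj_on (\<lambda>\<chi>. \<chi> g) (mult_chars :: ('a \<Rightarrow> complex) set)"
  proof (intro inj_onI ext)
    fix \<chi> \<psi> :: "'a \<Rightarrow> complex" and x
    assume "\<chi> \<in> mult_chars" "\<psi> \<in> mult_chars" "\<chi> g = \<psi> g"
    then show "\<chi> x = \<psi> x"
      using dlog(1)[of x] by (cases "x = 0") (simp add: mult_char_0, metis mult_char_power)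
  qed
  moreover have "z \<in> (\<lambda>\<chi>. \<chi> g) ` mult_chars" if z: "z ^ ?n = 1" for z :: complex
  proof -
    \<comment> \<open>Multiplicative because \<open>z ^ i\<close>, like \<open>g ^ i\<close>,
      depends only on \<open>i\<close> modulo \<open>?n\<close>.\<close>
    define \<chi> where "\<chi> x = (if x = 0 then 0 else z ^ dlog x)" for x
    have zmod: "z ^ (i mod ?n) = z ^ i" for i
      by (rule power_mod_exponent[OF z])
    have pow: "\<chi> (g ^ i) = z ^ i" for i
      using g0 zmod[of i] by (simp add: \<chi>_def dlog_pow)
    have "\<chi> (x * y) = \<chi> x * \<chi> y" if "x \<noteq> 0" "y \<noteq> 0" for x y
      using pow[of "dlog x + dlog y"] dlog(1)[OF that(1)] dlog(1)[OF that(2)] that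
      by (simp add: power_add \<chi>_def)
    then have "\<chi> \<in> mult_chars"
      using pow[of 0] by (simp add: mult_chars_def \<chi>_def)
    moreover have "\<chi> g = z" using pow[of 1] by simp
    ultimately show ?thesis by blast
  qed
  ultimately show ?thesis
    using mult_char_power_card[OF _ g0] by (auto simp: bij_betw_def)
qed

lemma card_mult_chars: "card (mult_chars :: ('a::{finite,field} \<Rightarrow> complex) set) = CARD('a) - 1"
proof -
  obtain g :: 'a where g: "g \<noteq> 0" "bij_betw (\<lambda>i. g ^ i) {..<CARD('a) - 1} (UNIV - {0})"
    using ex_field_generator by blast
  then show ?thesis
    using bij_betw_same_card[OF bij_betw_mult_chars_roots_unity[OF g]] card_field_gt_1[where 'a='a]
    by (simp add: card_roots_unity_eq)
qed

text \<open>A character sending a generator to a primitive root of unity of order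
  \<open>CARD('a) - 1\<close> takes the value 1 only at 1.\<close>

lemma mult_chars_separate:
  fixes x :: "'a::{finite,field}"
  assumes "x \<noteq> 0" "x \<noteq> 1"
  shows "\<exists>\<psi>\<in>mult_chars. \<psi> x \<noteq> 1"
proof -
  let ?n = "CARD('a) - 1"
  obtain g :: 'a where g: "g \<noteq> 0" "bij_betw (\<lambda>i. g ^ i) {..<?n} (UNIV - {0})"
    using ex_field_generator by blast
  have n: "?n > 0" using card_field_gt_1[where 'a='a] by simp
  obtain i where i: "i < ?n" "x = g ^ i"
    using g assms by (auto simp: bij_betw_def)
  have "i \<noteq> 0" using i assms by (intro notI) simp
  \<comment> \<open>The root with index 1 in the enumeration of \<open>bij_betw_roots_unity\<close>;
    \<open>x\<close> will go to index \<open>i\<close>, while index 0 is the root 1.\<close>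
  define z where "z = cis (2 * pi * real 1 / real ?n)"
  note B = bij_betw_roots_unity[OF n]
  have "z ^ ?n = 1"
    using n by (simp add: z_def DeMoivre)
  then have "z \<in> (\<lambda>\<chi>. \<chi> g) ` mult_chars"
    using bij_betw_imp_surj_on[OF bij_betw_mult_chars_roots_unity[OF g]] by simp
  then obtain \<psi> :: "'a \<Rightarrow> complex" where \<psi>: "\<psi> \<in> mult_chars" "\<psi> g = z"
    by blast
  have "\<psi> x = cis (2 * pi * real i / real ?n)"
    using \<psi> i by (simp add: mult_char_power z_def DeMoivre mult_ac)
  moreover have "cis (2 * pi * real i / real ?n) \<noteq> cis (2 * pi * real 0 / real ?n)"
    using inj_onD[OF bij_betw_imp_inj_on[OF B], of i 0] i \<open>i \<noteq> 0\<close> n by blast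
  ultimately show ?thesis using \<psi>(1) by (intro bexI[of _ \<psi>]) auto
qed

section \<open>The group of characters and orthogonality\<close>

lemma char_mult_mem: "\<chi> \<in> mult_chars \<Longrightarrow> \<psi> \<in> mult_chars \<Longrightarrow> \<chi> \<odot> \<psi> \<in> mult_chars"
  by (simp add: mult_chars_def char_mult_def)

lemma char_cnj_mem: "\<chi> \<in> mult_chars \<Longrightarrow> char_cnj \<chi> \<in> mult_chars"
  by (simp add: mult_chars_def char_cnj_def)

lemma triv_char_mem: "triv_char \<in> mult_chars"
  by (simp add: mult_chars_def triv_char_def)

text \<open>For \<open>x \<noteq> 1\<close>, multiplication by a character \<open>\<psi>\<close>
  with \<open>\<psi> x \<noteq> 1\<close> permutes the characters, so the sum equals
  \<open>\<psi> x\<close> times itself and vanishes.\<close>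

lemma sum_mult_chars:
  fixes x :: "'a::{finite,field}"
  assumes "x \<noteq> 0"
  shows "(\<Sum>\<chi>\<in>mult_chars. \<chi> x) = (if x = 1 then of_nat CARD('a) - 1 else 0)"
proof (cases "x = 1")
  case True
  then show ?thesis
    using card_field_gt_1[where 'a='a] by (simp add: mult_char_1 card_mult_chars of_nat_diff)
next
  case False
  obtain \<psi> where \<psi>: "\<psi> \<in> mult_chars" "\<psi> x \<noteq> 1"
    using mult_chars_separate[OF assms False] by blast
  have inv: "\<psi> y * cnj (\<psi> y) = 1" if "y \<noteq> 0" for y
    using \<psi> that mult_char_mult[OF \<psi>(1), of y "inverse y"]
    by (simp add: mult_char_cnj mult_char_1)
  have ccl: "\<psi> \<odot> (char_cnj \<psi> \<odot> \<chi>) = \<chi>" "char_cnj \<psi> \<odot> (\<psi> \<odot> \<chi>) = \<chi>" if "\<chi> \<in> mult_chars" for \<chi>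
  proof -
    have "\<psi> y * cnj (\<psi> y) * \<chi> y = \<chi> y" for y
      using inv[of y] that by (cases "y = 0") (simp_all add: mult_char_0)
    then have "\<psi> y * (cnj (\<psi> y) * \<chi> y) = \<chi> y" "cnj (\<psi> y) * (\<psi> y * \<chi> y) = \<chi> y" for y
      by (simp_all only: mult_ac)
    then show "\<psi> \<odot> (char_cnj \<psi> \<odot> \<chi>) = \<chi>" "char_cnj \<psi> \<odot> (\<psi> \<odot> \<chi>) = \<chi>"
      by (simp_all add: fun_eq_iff char_mult_def char_cnj_def)
  qed
  have "(\<Sum>\<chi>\<in>mult_chars. \<chi> x) = (\<Sum>\<chi>\<in>mult_chars. (\<psi> \<odot> \<chi>) x)"
    by (rule sum.reindex_bij_witness[of _ "\<lambda>\<chi>. \<psi> \<odot> \<chi>" "\<lambda>\<chi>. char_cnj \<psi> \<odot> \<chi>"])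
       (use \<psi> in \<open>simp_all add: ccl char_mult_mem char_cnj_mem\<close>)
  also have "\<dots> = \<psi> x * (\<Sum>\<chi>\<in>mult_chars. \<chi> x)"
    by (simp add: char_mult_def sum_distrib_left)
  finally show ?thesis using \<psi> False by simp
qed

section \<open>Appell functions as character sums over the field\<close>

text \<open>Collects all dependence on \<open>X\<close> in a single value of \<open>X\<close>, so
  that a later sum over \<open>X\<close> can be evaluated by orthogonality.\<close>

lemma char_binom_mult_eq:
  fixes B D X :: "'a::{finite,field} \<Rightarrow> complex"
  assumes "B \<in> mult_chars" "D \<in> mult_chars" "X \<in> mult_chars"
  shows "char_binom (B \<odot> X) (D \<odot> X) =
    D (-1) / of_nat CARD('a) * (\<Sum>t\<in>UNIV - {0, 1}. B t * cnj (D (1 - t)) * X (- t / (1 - t)))"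
proof -
  have *: "X (-1) * (B t * X t * cnj (D (1 - t) * X (1 - t))) =
      B t * cnj (D (1 - t)) * X (- t / (1 - t))" for t
  proof -
    have "X (- t / (1 - t)) = X ((-1) * t * inverse (1 - t))"
      by (simp add: divide_inverse)
    also have "\<dots> = X (-1) * X t * cnj (X (1 - t))"
      using assms by (simp only: mult_char_mult mult_char_cnj)
    finally show ?thesis by (simp add: mult_ac)
  qed
  \<comment> \<open>At \<open>t = 0\<close> and \<open>t = 1\<close> some character is evaluated at
    0, so these terms drop out.\<close>
  have "jacobi_sum (B \<odot> X) (char_cnj (D \<odot> X)) =
      (\<Sum>t\<in>UNIV - {0, 1}. B t * X t * cnj (D (1 - t) * X (1 - t)))"
    unfolding jacobi_sum_def char_mult_def char_cnj_def
    by (rule sum.mono_neutral_right) (use assms in \<open>auto simp: mult_char_0\<close>)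
  then have "char_binom (B \<odot> X) (D \<odot> X) = D (-1) / of_nat CARD('a) *
      (\<Sum>t\<in>UNIV - {0, 1}. X (-1) * (B t * X t * cnj (D (1 - t) * X (1 - t))))"
    by (simp add: char_binom_def char_mult_def sum_distrib_left mult_ac)
  then show ?thesis by (simp only: *)
qed

text \<open>The finite field analogue of the binomial series of \<open>(1 - x)\<close> to the power
  \<open>-b\<close>. Orthogonality keeps only the term \<open>t = 1 / (1 - x)\<close>.\<close>

lemma sum_char_binom:
  fixes B :: "'a::{finite,field} \<Rightarrow> complex"
  assumes B: "B \<in> mult_chars" and x: "x \<noteq> 0"
  shows "(\<Sum>\<chi>\<in>mult_chars. char_binom (B \<odot> \<chi>) \<chi> * \<chi> x) =
    (of_nat CARD('a) - 1) / of_nat CARD('a) * cnj (B (1 - x))"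
proof -
  let ?q = "of_nat CARD('a) :: complex"
  have "char_binom (B \<odot> \<chi>) \<chi> * \<chi> x = 1 / ?q * (\<Sum>t\<in>UNIV - {0, 1}. B t * \<chi> (- t * x / (1 - t)))"
    if \<chi>: "\<chi> \<in> mult_chars" for \<chi>
  proof -
    have "triv_char \<odot> \<chi> = \<chi>"
      using \<chi> by (auto simp: fun_eq_iff char_mult_def triv_char_def mult_char_0)
    then have "char_binom (B \<odot> \<chi>) \<chi> =
        1 / ?q * (\<Sum>t\<in>UNIV - {0, 1}. B t * \<chi> (- t / (1 - t)))"
      using char_binom_mult_eq[OF B triv_char_mem \<chi>] by (simp add: triv_char_def)
    then show ?thesis
      using \<chi> by (simp add: sum_distrib_right mult.assoc mult_char_mult[symmetric])
  qed
  then have "(\<Sum>\<chi>\<in>mult_chars. char_binom (B \<odot> \<chi>) \<chi> * \<chi> x) =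
      1 / ?q * (\<Sum>t\<in>UNIV - {0, 1}. B t * (\<Sum>\<chi>\<in>mult_chars. \<chi> (- t * x / (1 - t))))"
    by (simp add: sum_distrib_left sum.swap[of _ mult_chars])
  also have "(\<Sum>t\<in>UNIV - {0, 1}. B t * (\<Sum>\<chi>\<in>mult_chars. \<chi> (- t * x / (1 - t)))) =
      (\<Sum>t\<in>UNIV - {0, 1}. if t = inverse (1 - x) then (?q - 1) * B t else 0)"
  proof (rule sum.cong)
    fix t :: 'a
    assume t: "t \<in> UNIV - {0, 1}"
    have "- t * x / (1 - t) = 1 \<longleftrightarrow> t * (1 - x) = 1"
      using t by (auto simp: field_simps)
    \<comment> \<open>For \<open>x = 1\<close> neither side can hold: \<open>inverse 0 = 0\<close>
      lies outside the range of \<open>t\<close>. This matches \<open>B 0 = 0\<close> in the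
      result.\<close>
    also have "\<dots> \<longleftrightarrow> t = inverse (1 - x)"
      using t by (cases "x = 1") (auto simp: field_simps)
    finally show "B t * (\<Sum>\<chi>\<in>mult_chars. \<chi> (- t * x / (1 - t))) =
        (if t = inverse (1 - x) then (?q - 1) * B t else 0)"
      using t x by (subst sum_mult_chars) (auto simp: mult.commute)
  qed simp
  also have "\<dots> = (?q - 1) * cnj (B (1 - x))"
    using x B by (auto simp: mult_char_cnj mult_char_0 field_simps)
  finally show ?thesis by simp
qed

text \<open>After \<open>char_binom_mult_eq\<close>, for fixed \<open>t\<close> the double sum is a
  product of a sum over \<open>\<chi>\<^sub>1\<close> and a sum over \<open>\<chi>\<^sub>2\<close>,
  each given by \<open>sum_char_binom\<close>.\<close>

lemma appell_F1_eq:
  fixes A B\<^sub>1 B\<^sub>2 D :: "'a::{finite,field} \<Rightarrow> complex"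
  assumes "A \<in> mult_chars" "B\<^sub>1 \<in> mult_chars" "B\<^sub>2 \<in> mult_chars" "D \<in> mult_chars"
    and xy: "x \<noteq> 0" "y \<noteq> 0"
  shows "of_nat CARD('a) * appell_F1 A B\<^sub>1 B\<^sub>2 D x y =
    D (-1) * (\<Sum>t\<in>UNIV - {0, 1}. A t * cnj (D (1 - t)) *
      cnj (B\<^sub>1 (1 + t * x / (1 - t))) * cnj (B\<^sub>2 (1 + t * y / (1 - t))))"
proof -
  let ?q = "of_nat CARD('a) :: complex"
  define K where "K B z = (\<Sum>\<chi>\<in>mult_chars. char_binom (B \<odot> \<chi>) \<chi> * \<chi> z)"
    for B and z :: 'a
  have q: "?q \<noteq> 0" "?q - 1 \<noteq> 0"
    using card_field_gt_1[where 'a='a]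
    by (simp_all only: right_minus_eq of_nat_eq_0_iff of_nat_eq_1_iff)
  have "(\<Sum>\<chi>\<^sub>1\<in>mult_chars. \<Sum>\<chi>\<^sub>2\<in>mult_chars.
        char_binom (A \<odot> \<chi>\<^sub>1 \<odot> \<chi>\<^sub>2) (D \<odot> \<chi>\<^sub>1 \<odot> \<chi>\<^sub>2) *
        char_binom (B\<^sub>1 \<odot> \<chi>\<^sub>1) \<chi>\<^sub>1 * char_binom (B\<^sub>2 \<odot> \<chi>\<^sub>2) \<chi>\<^sub>2 * \<chi>\<^sub>1 x * \<chi>\<^sub>2 y) =
     (\<Sum>\<chi>\<^sub>1\<in>mult_chars. \<Sum>\<chi>\<^sub>2\<in>mult_chars. \<Sum>t\<in>UNIV - {0, 1}.
        D (-1) / ?q * (A t * cnj (D (1 - t))) *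
        (char_binom (B\<^sub>1 \<odot> \<chi>\<^sub>1) \<chi>\<^sub>1 * \<chi>\<^sub>1 (- t / (1 - t) * x)) *
        (char_binom (B\<^sub>2 \<odot> \<chi>\<^sub>2) \<chi>\<^sub>2 * \<chi>\<^sub>2 (- t / (1 - t) * y)))"
  proof (intro sum.cong refl)
    fix \<chi>\<^sub>1 \<chi>\<^sub>2 :: "'a \<Rightarrow> complex"
    assume \<chi>: "\<chi>\<^sub>1 \<in> mult_chars" "\<chi>\<^sub>2 \<in> mult_chars"
    have assoc: "C \<odot> \<chi>\<^sub>1 \<odot> \<chi>\<^sub>2 = C \<odot> (\<chi>\<^sub>1 \<odot> \<chi>\<^sub>2)" for C
      by (simp add: fun_eq_iff char_mult_def mult.assoc)
    have "char_binom (A \<odot> \<chi>\<^sub>1 \<odot> \<chi>\<^sub>2) (D \<odot> \<chi>\<^sub>1 \<odot> \<chi>\<^sub>2) = (\<Sum>t\<in>UNIV - {0, 1}.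
        D (-1) / ?q * (A t * cnj (D (1 - t))) * (\<chi>\<^sub>1 (- t / (1 - t)) * \<chi>\<^sub>2 (- t / (1 - t))))"
      unfolding assoc char_binom_mult_eq[OF assms(1,4) char_mult_mem[OF \<chi>]] sum_distrib_left
      by (simp only: char_mult_def mult.assoc)
    then show "char_binom (A \<odot> \<chi>\<^sub>1 \<odot> \<chi>\<^sub>2) (D \<odot> \<chi>\<^sub>1 \<odot> \<chi>\<^sub>2) *
        char_binom (B\<^sub>1 \<odot> \<chi>\<^sub>1) \<chi>\<^sub>1 * char_binom (B\<^sub>2 \<odot> \<chi>\<^sub>2) \<chi>\<^sub>2 * \<chi>\<^sub>1 x * \<chi>\<^sub>2 y =
      (\<Sum>t\<in>UNIV - {0, 1}. D (-1) / ?q * (A t * cnj (D (1 - t))) *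
        (char_binom (B\<^sub>1 \<odot> \<chi>\<^sub>1) \<chi>\<^sub>1 * \<chi>\<^sub>1 (- t / (1 - t) * x)) *
        (char_binom (B\<^sub>2 \<odot> \<chi>\<^sub>2) \<chi>\<^sub>2 * \<chi>\<^sub>2 (- t / (1 - t) * y)))"
      unfolding mult_char_mult[OF \<chi>(1), of _ x] mult_char_mult[OF \<chi>(2), of _ y]
      by (simp only: sum_distrib_right) (simp only: mult_ac)
  qed
  also have "\<dots> = (\<Sum>t\<in>UNIV - {0, 1}. D (-1) / ?q * (A t * cnj (D (1 - t))) *
      K B\<^sub>1 (- t / (1 - t) * x) * K B\<^sub>2 (- t / (1 - t) * y))"
    by (simp only: sum.swap[of _ "UNIV - {0, 1}" mult_chars] K_def mult.assoc sum_product)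
       (simp only: sum_distrib_left)
  also have "\<dots> = (\<Sum>t\<in>UNIV - {0, 1}. D (-1) / ?q * (A t * cnj (D (1 - t))) *
      ((?q - 1) / ?q * cnj (B\<^sub>1 (1 + t * x / (1 - t)))) *
      ((?q - 1) / ?q * cnj (B\<^sub>2 (1 + t * y / (1 - t)))))"
  proof (intro sum.cong refl)
    fix t :: 'a
    assume t: "t \<in> UNIV - {0, 1}"
    \<comment> \<open>The argument is nonzero for these \<open>t\<close> and \<open>z\<close>, as
      \<open>sum_char_binom\<close> requires.\<close>
    have "K B (- t / (1 - t) * z) = (?q - 1) / ?q * cnj (B (1 + t * z / (1 - t)))"
      if "B \<in> mult_chars" "z \<noteq> 0" for B z
      using t that unfolding K_def by (subst sum_char_binom) auto
    then show "D (-1) / ?q * (A t * cnj (D (1 - t))) *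
          K B\<^sub>1 (- t / (1 - t) * x) * K B\<^sub>2 (- t / (1 - t) * y) =
        D (-1) / ?q * (A t * cnj (D (1 - t))) *
          ((?q - 1) / ?q * cnj (B\<^sub>1 (1 + t * x / (1 - t)))) *
          ((?q - 1) / ?q * cnj (B\<^sub>2 (1 + t * y / (1 - t))))"
      using assms by simp
  qed
  \<comment> \<open>Three binomials give \<open>1 / ?q\<close> each and two orthogonality sums give
    \<open>?q - 1\<close> each. The prefactor of \<open>appell_F1\<close> leaves
    \<open>1 / ?q\<close>, whence the factor on the left of the claim.\<close>
  also have "\<dots> = (?q - 1)\<^sup>2 / ?q ^ 3 * (D (-1) * (\<Sum>t\<in>UNIV - {0, 1}. A t * cnj (D (1 - t)) *
      cnj (B\<^sub>1 (1 + t * x / (1 - t))) * cnj (B\<^sub>2 (1 + t * y / (1 - t)))))"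
    by (simp add: sum_distrib_left mult_ac power2_eq_square power3_eq_cube)
  finally show ?thesis
    using q by (simp add: appell_F1_def power2_eq_square power3_eq_cube)
qed

section \<open>Cubic characters\<close>

text \<open>Stated over an integral domain because it serves both the finite field and the complex
  values of characters.\<close>

lemma sum_powers_cube_root_unity:
  fixes v :: "'a::idom"
  assumes "v ^ 3 = 1" "v \<noteq> 1"
  shows "1 + v + v\<^sup>2 = 0"
proof -
  have "(v - 1) * (1 + v + v\<^sup>2) = v ^ 3 - 1"
    by (simp add: algebra_simps power2_eq_square power3_eq_cube)
  then show ?thesis using assms by simp
qed

text \<open>The order of \<open>v\<close> is exactly 3, since \<open>v\<^sup>2 = 1\<close> would
  give \<open>v = v ^ 3 = 1\<close>.\<close>

lemma cube_root_unity_power_eq_1D: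
  fixes v :: "'a::idom"
  assumes v: "v ^ 3 = 1" "v \<noteq> 1" and i: "v ^ i = 1"
  shows "3 dvd i"
proof -
  have "v ^ i = v ^ (i mod 3)"
    by (rule power_mod_exponent[OF v(1), symmetric])
  moreover have "v\<^sup>2 \<noteq> 1"
    using v by (metis mult_1 power2_eq_square power3_eq_cube)
  moreover have "i mod 3 = 0 \<or> i mod 3 = 1 \<or> i mod 3 = 2" by auto
  ultimately show ?thesis using i v by auto
qed

text \<open>The roots are \<open>b\<close>, \<open>b * w\<close> and \<open>b * w ^ 2\<close>,
  distinct because \<open>w\<close> has order 3.\<close>

lemma card_cube_roots_of_cube:
  fixes b w :: "'a::idom"
  assumes w: "w ^ 3 = 1" "w \<noteq> 1" and b: "b \<noteq> 0"
  shows "card {y. y ^ 3 = b ^ 3} = 3"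
proof -
  have "y ^ 3 - b ^ 3 = (y - b) * (y - b * w) * (y - b * w ^ 2)" for y
  proof -
    have "(y - b) * (y - b * w) * (y - b * w ^ 2) =
        y ^ 3 - b ^ 3 * w ^ 3 - y * b * (1 + w + w\<^sup>2) * (y - b * w)"
      by (simp add: algebra_simps power2_eq_square power3_eq_cube)
    then show ?thesis using w by (simp add: sum_powers_cube_root_unity)
  qed
  then have "{y. y ^ 3 = b ^ 3} = {b, b * w, b * w ^ 2}"
    by (auto simp: eq_iff_diff_eq_0[of "_ ^ 3"] simp del: right_minus_eq) auto
  moreover have "w\<^sup>2 \<noteq> 1" "w \<noteq> w\<^sup>2"
    using w by (auto simp: power2_eq_square power3_eq_cube)
  ultimately show ?thesis using w b by simp
qed

text \<open>The case distinction matters for \<open>k = 0\<close>, where \<open>0 ^ 0 = 1\<close>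
  but \<open>triv_char 0 = 0\<close>.\<close>

lemma char_pow_apply:
  assumes "\<chi> \<in> mult_chars"
  shows "char_pow \<chi> k x = (if x = 0 then 0 else \<chi> x ^ k)"
  by (induction k) (simp_all add: triv_char_def char_mult_def mult_char_0[OF assms])

lemma char_pow_mem: "\<chi> \<in> mult_chars \<Longrightarrow> char_pow \<chi> k \<in> mult_chars"
  by (induction k) (simp_all add: triv_char_mem char_mult_mem)

lemma char_order_cube:
  assumes "\<chi> \<in> mult_chars" "has_char_order \<chi> 3" "x \<noteq> 0"
  shows "\<chi> x ^ 3 = 1"
proof -
  have "char_pow \<chi> 3 x = triv_char x" using assms by (simp add: has_char_order_def)
  then show ?thesis using assms by (simp add: char_pow_apply triv_char_def)
qed

text \<open>The value of \<open>\<chi>\<close> at a generator is a primitive cube root of unity, so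
  \<open>\<chi> a = 1\<close> exactly for nonzero cubes, which have three roots. At other units the
  right side is \<open>1 + v + v\<^sup>2 = 0\<close>; at 0 only the 1 remains.\<close>

lemma card_cube_roots:
  fixes \<chi> :: "'a::{finite,field} \<Rightarrow> complex" and a :: 'a
  assumes \<chi>: "\<chi> \<in> mult_chars" and ord: "has_char_order \<chi> 3"
  shows "of_nat (card {y. y ^ 3 = a}) = 1 + \<chi> a + cnj (\<chi> a)"
proof -
  let ?n = "CARD('a) - 1"
  obtain g :: 'a where g: "g \<noteq> 0" and bij: "bij_betw (\<lambda>i. g ^ i) {..<?n} (UNIV - {0})"
    using ex_field_generator by blast
  have n: "?n > 0" using card_field_gt_1[where 'a='a] by simp
  have gen: "\<exists>i. x = g ^ i" if "x \<noteq> 0" for x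
    using bij that by (auto simp: bij_betw_def)
  have cube: "\<chi> x ^ 3 = 1" if "x \<noteq> 0" for x
    by (rule char_order_cube[OF \<chi> ord that])
  \<comment> \<open>Otherwise \<open>\<chi>\<close> would be trivial on all powers of
    \<open>g\<close>, against its order 3.\<close>
  have g1: "\<chi> g \<noteq> 1"
  proof
    assume "\<chi> g = 1"
    then have "char_pow \<chi> 1 x = triv_char x" for x
      using gen[of x] by (auto simp: char_pow_apply[OF \<chi>] triv_char_def mult_char_power[OF \<chi>]
          simp del: char_pow.simps One_nat_def)
    moreover have "0 < (1 :: nat) \<and> (1 :: nat) < 3 \<longrightarrow> char_pow \<chi> 1 \<noteq> triv_char"
      using ord unfolding has_char_order_def by blast
    ultimately show False by (simp add: fun_eq_iff del: char_pow.simps One_nat_def)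
  qed
  have dvd: "3 dvd i" if "\<chi> (g ^ i) = 1" for i
    using cube_root_unity_power_eq_1D[OF cube[OF g] g1] that by (simp add: mult_char_power[OF \<chi>])
  consider "a = 0" | "a \<noteq> 0" "\<chi> a = 1" | "a \<noteq> 0" "\<chi> a \<noteq> 1" by blast
  then show ?thesis
  proof cases
    case 1
    then show ?thesis using \<chi> by (simp add: mult_char_0)
  next
    case 2
    obtain i where i: "a = g ^ i" using gen 2 by blast
    with 2 have "3 dvd i" by (intro dvd) simp
    then obtain j where j: "i = 3 * j" by blast
    have "a = (g ^ j) ^ 3" by (simp add: i j mult.commute flip: power_mult)
    \<comment> \<open>\<open>\<chi>\<close> is 1 at \<open>g ^ ?n = 1\<close>, so \<open>dvd\<close>
      applies; \<open>g ^ (?n div 3)\<close> is then a primitive cube root of unity in the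
      field.\<close>
    moreover have "3 dvd ?n"
      by (rule dvd) (simp only: field_power_card_minus_1[OF g] mult_char_1[OF \<chi>])
    then obtain k where k: "?n = 3 * k" by blast
    have "(g ^ k) ^ 3 = 1"
      using field_power_card_minus_1[OF g] by (simp only: k mult.commute flip: power_mult)
    moreover have "g ^ k \<noteq> 1"
    proof
      assume "g ^ k = 1"
      moreover have "k < ?n" using k n by arith
      ultimately have "k = 0"
        using n by (intro inj_onD[OF bij_betw_imp_inj_on[OF bij], of k 0]) simp_all
      then show False using k n by simp
    qed
    ultimately have "card {y. y ^ 3 = a} = 3"
      using card_cube_roots_of_cube[of "g ^ k" "g ^ j"] g by simp
    then show ?thesis using 2 by simp
  next
    case 3
    have "y ^ 3 \<noteq> a" for y
    proof
      assume y: "y ^ 3 = a"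
      then have "y \<noteq> 0" using 3 by auto
      then show False using 3 cube[of y] y by (simp flip: mult_char_power[OF \<chi>])
    qed
    then have "{y. y ^ 3 = a} = {}" by blast
    moreover have "cnj (\<chi> a) = (\<chi> a)\<^sup>2"
    proof -
      have "\<chi> a * cnj (\<chi> a) = 1"
        using 3 by (simp add: mult_char_cnj[OF \<chi>] mult_char_1[OF \<chi>] flip: mult_char_mult[OF \<chi>])
      moreover have "\<chi> a * (\<chi> a)\<^sup>2 = 1"
        using cube[of a] 3 by (simp add: power2_eq_square power3_eq_cube mult.assoc)
      ultimately show ?thesis by (metis mult_cancel_left mult_zero_left zero_neq_one)
    qed
    ultimately show ?thesis using sum_powers_cube_root_unity[OF cube[of a]] 3 by simp
  qed
qed

text \<open>The hypothesis \<open>cube\<close> holds for a cubic character and for its square, so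
  both values of \<open>j\<close> are covered.\<close>

lemma appell_F1_cubic:
  fixes \<chi> :: "'a::{finite,field} \<Rightarrow> complex"
  assumes \<chi>: "\<chi> \<in> mult_chars" and cube: "\<And>x. x \<noteq> 0 \<Longrightarrow> \<chi> x ^ 3 = 1"
    and lm: "l \<noteq> 0" "m \<noteq> 0"
  shows "of_nat CARD('a) * appell_F1 \<chi> \<chi> \<chi> triv_char l m =
    (\<Sum>x\<in>UNIV. cnj (\<chi> (x * (x - 1) * (x - l) * (x - m))))"
proof -
  have "of_nat CARD('a) * appell_F1 \<chi> \<chi> \<chi> triv_char l m =
      (\<Sum>t\<in>UNIV - {0, 1}. \<chi> t * cnj (triv_char (1 - t)) *
        cnj (\<chi> (1 + t * l / (1 - t))) * cnj (\<chi> (1 + t * m / (1 - t))))"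
    using appell_F1_eq[OF \<chi> \<chi> \<chi> triv_char_mem lm] by (simp add: triv_char_def)
  also have "\<dots> = (\<Sum>x\<in>UNIV - {0, 1}. cnj (\<chi> (x * (x - 1) * (x - l) * (x - m))))"
  proof (rule sum.reindex_bij_witness[of _ "\<lambda>x. 1 / (1 - x)" "\<lambda>t. (t - 1) / t"])
    fix t :: 'a
    assume t: "t \<in> UNIV - {0, 1}"
    define x where "x = (t - 1) / t"
    have x: "x \<noteq> 0" "x \<noteq> 1" using t by (auto simp: x_def field_simps)
    have t_eq: "t = inverse (1 - x)" using t by (simp add: x_def field_simps)
    have "1 + t * z / (1 - t) = (x - z) / x" for z
      using t by (simp add: x_def field_simps)
    moreover have "\<chi> t = cnj (\<chi> (1 - x))"
      unfolding t_eq by (simp add: mult_char_cnj[OF \<chi>])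
    ultimately have "\<chi> t * cnj (triv_char (1 - t)) *
        cnj (\<chi> (1 + t * l / (1 - t))) * cnj (\<chi> (1 + t * m / (1 - t))) =
        cnj (\<chi> (1 - x)) * cnj (\<chi> ((x - l) / x)) * cnj (\<chi> ((x - m) / x))"
      using t by (simp add: triv_char_def)
    also have "\<dots> = cnj (\<chi> ((1 - x) * ((x - l) / x) * ((x - m) / x)))"
      by (simp only: mult_char_mult[OF \<chi>] complex_cnj_mult)
    \<comment> \<open>The argument differs from the quartic by the cube of \<open>- 1 / x\<close>,
      on which \<open>\<chi>\<close> is 1.\<close>
    also have "(1 - x) * ((x - l) / x) * ((x - m) / x) =
        x * (x - 1) * (x - l) * (x - m) * (- 1 / x) ^ 3"
      using x by (simp add: field_simps power3_eq_cube)
    also have "\<chi> \<dots> = \<chi> (x * (x - 1) * (x - l) * (x - m))"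
      using cube[of "- 1 / x"] x
      by (simp only: mult_char_mult[OF \<chi>, of _ "_ ^ 3"] mult_char_power[OF \<chi>]) simp
    finally show "cnj (\<chi> ((t - 1) / t * ((t - 1) / t - 1) * ((t - 1) / t - l) * ((t - 1) / t - m))) =
        \<chi> t * cnj (triv_char (1 - t)) *
          cnj (\<chi> (1 + t * l / (1 - t))) * cnj (\<chi> (1 + t * m / (1 - t)))"
      by (simp only: x_def)
  qed (auto simp: field_simps)
  \<comment> \<open>The missing points 0 and 1 are roots of the quartic.\<close>
  also have "\<dots> = (\<Sum>x\<in>UNIV. cnj (\<chi> (x * (x - 1) * (x - l) * (x - m))))"
    by (rule sum.mono_neutral_left) (auto simp: mult_char_0[OF \<chi>])
  finally show ?thesis .
qed

section \<open>Points of the curve\<close>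

lemma proj_rel_Image_iff:
  "(x', y', z') \<in> proj_rel `` {(x, y, z)} \<longleftrightarrow>
    (x, y, z) \<noteq> (0, 0, 0) \<and> (\<exists>c. c \<noteq> 0 \<and> x' = c * x \<and> y' = c * y \<and> z' = c * z)"
  by (auto simp: proj_rel_def)

lemma proj_rel_Image_scale:
  fixes c x y z :: "'a::field"
  assumes "c \<noteq> 0"
  shows "proj_rel `` {(c * x, c * y, c * z)} = proj_rel `` {(x, y, z)}"
proof -
  have "(\<exists>d. d \<noteq> 0 \<and> x' = d * (c * x) \<and> y' = d * (c * y) \<and> z' = d * (c * z)) \<longleftrightarrow>
      (\<exists>d. d \<noteq> 0 \<and> x' = d * x \<and> y' = d * y \<and> z' = d * z)" (is "?L \<longleftrightarrow> ?R") for x' y' z'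
  proof
    assume ?L
    then obtain d where "d \<noteq> 0" "x' = d * (c * x)" "y' = d * (c * y)" "z' = d * (c * z)" by blast
    then show ?R using assms by (intro exI[of _ "d * c"]) simp
  next
    assume ?R
    then obtain d where "d \<noteq> 0" "x' = d * x" "y' = d * y" "z' = d * z" by blast
    then show ?L using assms by (intro exI[of _ "d / c"]) simp
  qed
  then have "v \<in> proj_rel `` {(c * x, c * y, c * z)} \<longleftrightarrow> v \<in> proj_rel `` {(x, y, z)}" for v
    using assms by (cases v) (simp add: proj_rel_def)
  then show ?thesis by blast
qed

text \<open>Homogeneity makes vanishing independent of the chosen coordinates.\<close>

lemma quartic_form_scale:
  "quartic_form l m (c * x, c * y, c * z) = c ^ 4 * quartic_form l m (x, y, z)"
  by (simp add: algebra_simps power3_eq_cube power4_eq_xxxx)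

text \<open>On the line \<open>z = 0\<close> the equation becomes \<open>x ^ 4 = 0\<close>, leaving
  one point at infinity; all other points are normalized to \<open>z = 1\<close>.\<close>

lemma curve_points_eq:
  fixes l m :: "'a::field"
  shows "curve_points l m = insert (proj_rel `` {(0, 1, 0)})
    ((\<lambda>(x, y). proj_rel `` {(x, y, 1)}) ` {(x, y). y ^ 3 = x * (x - 1) * (x - l) * (x - m)})"
    (is "_ = insert ?P (?f ` ?A)")
proof (intro equalityI subsetI)
  fix P
  assume P: "P \<in> curve_points l m"
  then obtain x y z where xyz: "(x, y, z) \<noteq> (0, 0, 0)" "P = proj_rel `` {(x, y, z)}"
    by (auto simp: curve_points_def proj_plane_def quotient_def)
  have "(x, y, z) \<in> P"
    unfolding xyz(2) proj_rel_Image_iff using xyz(1) by (intro conjI exI[of _ 1]) auto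
  then have form: "quartic_form l m (x, y, z) = 0"
    using P unfolding curve_points_def by blast
  show "P \<in> insert ?P (?f ` ?A)"
  proof (cases "z = 0")
    case True
    then have "x = 0" "y \<noteq> 0" using form xyz(1) by auto
    then show ?thesis
      using True xyz(2) proj_rel_Image_scale[of y 0 1 0] by simp
  next
    case False
    have "z ^ 4 * quartic_form l m (x / z, y / z, 1) = 0"
      using form False quartic_form_scale[of l m z "x / z" "y / z" 1] by simp
    then have "(x / z, y / z) \<in> ?A" using False quartic_form_affine by auto
    moreover have "P = ?f (x / z, y / z)"
      using False xyz(2) proj_rel_Image_scale[of z "x / z" "y / z" 1] by simp
    ultimately show ?thesis by blast
  qed
next
  fix P
  assume "P \<in> insert ?P (?f ` ?A)"
  then have "\<exists>x y z. (x, y, z) \<noteq> (0, 0, 0) \<and> P = proj_rel `` {(x, y, z)} \<and>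
      quartic_form l m (x, y, z) = 0"
  proof (elim insertE imageE)
    assume "P = ?P"
    then show ?thesis by (intro exI[of _ "0 :: 'a"] exI[of _ "1 :: 'a"] conjI) auto
  next
    fix a
    assume "P = ?f a" "a \<in> ?A"
    then show ?thesis
      by (intro exI[of _ "fst a"] exI[of _ "snd a"] exI[of _ "1 :: 'a"] conjI) auto
  qed
  then obtain x y z where xyz: "(x, y, z) \<noteq> (0, 0, 0)" "P = proj_rel `` {(x, y, z)}"
      and form: "quartic_form l m (x, y, z) = 0"
    by blast
  have "quartic_form l m v = 0" if "v \<in> P" for v
  proof -
    obtain x' y' z' where v: "v = (x', y', z')" by (cases v)
    then obtain c where "x' = c * x" "y' = c * y" "z' = c * z"
      using \<open>v \<in> P\<close> unfolding xyz(2) v proj_rel_Image_iff by blast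
    then show ?thesis using form by (simp only: v quartic_form_scale mult_zero_right)
  qed
  moreover have "P \<in> proj_plane"
    using xyz by (auto simp: proj_plane_def quotient_def)
  ultimately show "P \<in> curve_points l m" by (simp add: curve_points_def)
qed

text \<open>Comparing last coordinates, the scaling factor between two affine representatives is 1,
  and none exists between an affine point and the one at infinity.\<close>

lemma card_curve_points:
  fixes l m :: "'a::{finite,field}"
  shows "card (curve_points l m) =
    1 + (\<Sum>x\<in>UNIV. card {y. y ^ 3 = x * (x - 1) * (x - l) * (x - m)})"
proof -
  let ?A = "{(x, y). y ^ 3 = x * (x - 1) * (x - l) * (x - m)}"
  let ?f = "\<lambda>(x, y). proj_rel `` {(x, y, 1 :: 'a)}"
  have self: "(x, y, 1) \<in> proj_rel `` {(x, y, 1)}" for x y :: 'a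
    unfolding proj_rel_Image_iff by (intro conjI exI[of _ 1]) auto
  have "inj_on ?f ?A"
  proof (rule inj_onI, clarify)
    fix x y x' y' :: 'a
    assume "proj_rel `` {(x, y, 1)} = proj_rel `` {(x', y', 1)}"
    then have "(x, y, 1) \<in> proj_rel `` {(x', y', 1)}" using self[of x y] by simp
    then show "x = x' \<and> y = y'" unfolding proj_rel_Image_iff by auto
  qed
  moreover have "proj_rel `` {(0, 1, 0)} \<notin> ?f ` ?A"
  proof clarify
    fix x y :: 'a
    assume "proj_rel `` {(0, 1, 0)} = proj_rel `` {(x, y, 1)}"
    then have "(x, y, 1) \<in> proj_rel `` {(0, 1, 0)}" using self[of x y] by simp
    then show False unfolding proj_rel_Image_iff by auto
  qed
  ultimately have "card (curve_points l m) = 1 + card ?A"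
    unfolding curve_points_eq by (simp add: card_image)
  also have "?A = Sigma UNIV (\<lambda>x. {y. y ^ 3 = x * (x - 1) * (x - l) * (x - m)})"
    by auto
  finally show ?thesis by (simp add: card_SigmaI)
qed

section \<open>The trace of Frobenius from the two cubic character sums\<close>

theorem theorem1p1:
  fixes p e q :: nat
    and \<chi>\<^sub>3 :: "'a::{finite,field} \<Rightarrow> complex"
    and l m :: 'a
  assumes "prime p" and "q = p ^ e" and "CARD('a) = q" and "[q = 1] (mod 3)"
    and "\<chi>\<^sub>3 \<in> mult_chars" and "has_char_order \<chi>\<^sub>3 3"
    and "l * m * (l - 1) * (m - 1) \<noteq> 0" and "l \<noteq> m"
  shows "of_int (frob_trace l m) =
    - of_nat q * (\<Sum>j=1..2. char_pow \<chi>\<^sub>3 (2 * j) (-1) *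
        appell_F1 (char_pow \<chi>\<^sub>3 j) (char_pow \<chi>\<^sub>3 j) (char_pow \<chi>\<^sub>3 j) triv_char l m)"
proof -
  note \<chi> = \<open>\<chi>\<^sub>3 \<in> mult_chars\<close>
  note cube = char_order_cube[OF \<chi> \<open>has_char_order \<chi>\<^sub>3 3\<close>]
  define f where "f x = x * (x - 1) * (x - l) * (x - m)" for x :: 'a
  have "of_int (frob_trace l m) =
      of_nat CARD('a) - (\<Sum>x\<in>UNIV. of_nat (card {y. y ^ 3 = f x}) :: complex)"
    by (simp add: frob_trace_def card_curve_points f_def)
  \<comment> \<open>The constant terms 1 of \<open>card_cube_roots\<close> add up to
    \<open>CARD('a)\<close> and cancel it.\<close>
  also have "\<dots> = - ((\<Sum>x\<in>UNIV. cnj (\<chi>\<^sub>3 (f x))) + (\<Sum>x\<in>UNIV. \<chi>\<^sub>3 (f x)))"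
    by (simp add: card_cube_roots[OF \<chi> \<open>has_char_order \<chi>\<^sub>3 3\<close>] sum.distrib)
  also have "(\<Sum>x\<in>UNIV. cnj (\<chi>\<^sub>3 (f x))) =
      of_nat q * appell_F1 (char_pow \<chi>\<^sub>3 1) (char_pow \<chi>\<^sub>3 1) (char_pow \<chi>\<^sub>3 1) triv_char l m"
  proof -
    have "char_pow \<chi>\<^sub>3 1 = \<chi>\<^sub>3"
      by (simp add: fun_eq_iff char_pow_apply[OF \<chi>] mult_char_0[OF \<chi>] del: char_pow.simps)
    then show ?thesis
      using appell_F1_cubic[OF \<chi> cube, of l m] assms(3,7) by (simp add: f_def)
  qed
  also have "(\<Sum>x\<in>UNIV. \<chi>\<^sub>3 (f x)) =
      of_nat q * appell_F1 (char_pow \<chi>\<^sub>3 2) (char_pow \<chi>\<^sub>3 2) (char_pow \<chi>\<^sub>3 2) triv_char l m"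
  proof -
    \<comment> \<open>The square of a cubic character is its conjugate, so the case
      \<open>j = 2\<close> yields the sum without conjugation.\<close>
    have cnj: "cnj (char_pow \<chi>\<^sub>3 2 x) = \<chi>\<^sub>3 x" for x
    proof (cases "x = 0")
      case False
      have "inverse x ^ 2 = x * inverse x ^ 3"
        using False by (simp add: power2_eq_square power3_eq_cube)
      then have "\<chi>\<^sub>3 (inverse x) ^ 2 = \<chi>\<^sub>3 x * \<chi>\<^sub>3 (inverse x) ^ 3"
        by (simp flip: mult_char_power[OF \<chi>] mult_char_mult[OF \<chi>])
      then show ?thesis
        using cube[of "inverse x"] False by (simp add: char_pow_apply[OF \<chi>] mult_char_cnj[OF \<chi>])
    qed (simp add: char_pow_apply[OF \<chi>] mult_char_0[OF \<chi>])
    have "char_pow \<chi>\<^sub>3 2 x ^ 3 = 1" if "x \<noteq> 0" for x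
    proof -
      have "(\<chi>\<^sub>3 x ^ 2) ^ 3 = (\<chi>\<^sub>3 x ^ 3) ^ 2" by (simp flip: power_mult)
      then show ?thesis using cube[OF that] that by (simp add: char_pow_apply[OF \<chi>])
    qed
    then show ?thesis
      using appell_F1_cubic[OF char_pow_mem[OF \<chi>, of 2], of l m] assms(3,7) cnj
      by (simp add: f_def)
  qed
  finally have trace: "of_int (frob_trace l m) =
    - (of_nat q * appell_F1 (char_pow \<chi>\<^sub>3 1) (char_pow \<chi>\<^sub>3 1) (char_pow \<chi>\<^sub>3 1) triv_char l m +
       of_nat q * appell_F1 (char_pow \<chi>\<^sub>3 2) (char_pow \<chi>\<^sub>3 2) (char_pow \<chi>\<^sub>3 2) triv_char l m)" .
  \<comment> \<open>The signs are powers of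
    \<open>\<chi>\<^sub>3 (-1) ^ 2 = \<chi>\<^sub>3 1\<close>, hence all 1.\<close>
  have "\<chi>\<^sub>3 (-1) ^ 2 = \<chi>\<^sub>3 ((-1) ^ 2)" by (simp only: mult_char_power[OF \<chi>])
  then have sign: "char_pow \<chi>\<^sub>3 (2 * j) (-1) = 1" for j
    by (simp add: char_pow_apply[OF \<chi>] power_mult mult_char_1[OF \<chi>])
  have "{1..2 :: nat} = {1, 2}" by auto
  then have two: "(\<Sum>j=1..2. h j) = h 1 + h 2" for h :: "nat \<Rightarrow> complex" by simp
  show ?thesis
    unfolding trace sign two mult_1 by (simp only: distrib_left mult_minus_left minus_add_distrib)
qed

end
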